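(* Let $k\geq 3$ be an integer and let $G$ be a connected graph on at least $k$ vertices. Then $G^{\lfloor 3k/2\rfloor}$ is $k$-ordered, and $G^{\lfloor 3k/2\rfloor+1}$ is $k$-ordered Hamiltonian.
   Context: All graphs are finite simple graphs. $d_G(v,w)$ denotes the distance in $G$ between vertices $v$ and $w$. For a positive integer $n$, the $n$-th power $G^n$ of a graph $G$ is the simple graph with the same vertex set as $G$ in which two distinct vertices $v,w$ are adjacent if and only if $d_G(v,w)\leq n$. A graph $G$ is $k$-ordered (resp. $k$-ordered Hamiltonian) if for any sequence $v_1,v_2,\dots,v_k$ of $k$ distinct vertices of $G$ there is a cycle (resp. a Hamiltonian cycle) in $G$ containing these vertices in the given order, i.e. traversing the cycle from $v_1$ in one of its two directions, one meets $v_1,v_2,\dots,v_k$ in this order before returning to $v_1$. *)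

theory Defs
  imports "Graph_Theory.Graph_Theory" "HOL-Library.Sublist"
begin

text \<open>
  A finite simple graph is a \<^locale>\<open>pair_graph\<close>: an undirected edge is represented by its two
  opposite arcs.
\<close>

definition graph_dist :: "'a pair_pre_digraph \<Rightarrow> 'a \<Rightarrow> 'a \<Rightarrow> ereal" where
  "graph_dist G v w = wf_digraph.\<mu> (with_proj G) (\<lambda>_. 1) v w"

definition graph_power :: "'a pair_pre_digraph \<Rightarrow> nat \<Rightarrow> 'a pair_pre_digraph" where
  "graph_power G n =
    \<lparr> pverts = pverts G,
      parcs = {(v, w). v \<in> pverts G \<and> w \<in> pverts G \<and> v \<noteq> w \<and> graph_dist G v w \<le> ereal (real n)} \<rparr>"

text \<open>
  The library's cycles are closed arc walks, so they carry a starting vertex and a direction;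
  such a walk is one particular traversal of an undirected cycle. Since every arc of a
  \<^locale>\<open>pair_graph\<close> has an opposite arc, both directions and all starting vertices of an
  undirected cycle occur among these walks. Going back and forth along a single edge is a
  library cycle, but not a cycle of a simple graph, hence the bound on the length.
\<close>

definition simple_cycle :: "'a pair_pre_digraph \<Rightarrow> ('a \<times> 'a) awalk \<Rightarrow> bool" where
  "simple_cycle G p \<longleftrightarrow> pre_digraph.cycle (with_proj G) p \<and> 3 \<le> length p"

text \<open>The vertices of a cycle in order of traversal; the starting vertex is not repeated at the end.\<close>

definition cycle_verts :: "('a \<times> 'a) awalk \<Rightarrow> 'a list" where
  "cycle_verts p = map fst p"

definition hamiltonian_cycle :: "'a pair_pre_digraph \<Rightarrow> ('a \<times> 'a) awalk \<Rightarrow> bool" where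
  "hamiltonian_cycle G p \<longleftrightarrow> simple_cycle G p \<and> set (cycle_verts p) = pverts G"

text \<open>The traversal \<open>p\<close> starts at the first vertex of \<open>vs\<close> and meets \<open>vs\<close> in the given order
  before returning to its start.\<close>

definition meets_in_order :: "('a \<times> 'a) awalk \<Rightarrow> 'a list \<Rightarrow> bool" where
  "meets_in_order p vs \<longleftrightarrow> hd (cycle_verts p) = hd vs \<and> subseq vs (cycle_verts p)"

text \<open>The next two notions are meant for \<open>k \<ge> 1\<close> only, as \<^term>\<open>hd []\<close> is unspecified.\<close>

definition k_ordered :: "nat \<Rightarrow> 'a pair_pre_digraph \<Rightarrow> bool" where
  "k_ordered k G \<longleftrightarrow>
    (\<forall>vs. length vs = k \<and> distinct vs \<and> set vs \<subseteq> pverts G \<longrightarrow>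
      (\<exists>p. simple_cycle G p \<and> meets_in_order p vs))"

definition k_ordered_hamiltonian :: "nat \<Rightarrow> 'a pair_pre_digraph \<Rightarrow> bool" where
  "k_ordered_hamiltonian k G \<longleftrightarrow>
    (\<forall>vs. length vs = k \<and> distinct vs \<and> set vs \<subseteq> pverts G \<longrightarrow>
      (\<exists>p. hamiltonian_cycle G p \<and> meets_in_order p vs))"

lemma (in pair_wf_digraph) graph_dist_le_iff:
  "graph_dist G v w \<le> ereal (real n) \<longleftrightarrow> (\<exists>p. awalk v p w \<and> length p \<le> n)"
proof
  have cost: "awalk_cost (\<lambda>_. 1) p = real (length p)" for p :: "('a \<times> 'a) awalk"
    by (induction p) auto
  show "\<exists>p. awalk v p w \<and> length p \<le> n" if le: "graph_dist G v w \<le> ereal (real n)"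
  proof (rule ccontr)
    assume none: "\<nexists>p. awalk v p w \<and> length p \<le> n"
    have "ereal (real (Suc n)) \<le> graph_dist G v w"
      unfolding graph_dist_def \<mu>_def
    proof (rule INF_greatest)
      fix p assume "p \<in> {p. awalk v p w}"
      with none have "Suc n \<le> length p" by auto
      then have "real (Suc n) \<le> real (length p)" by (rule of_nat_mono)
      then show "ereal (real (Suc n)) \<le> ereal (awalk_cost (\<lambda>_. 1) p)"
        unfolding cost by (simp only: ereal_less_eq)
    qed
    with le have "ereal (real (Suc n)) \<le> ereal (real n)" by (rule order_trans[rotated])
    then show False by simp
  qed
  show "graph_dist G v w \<le> ereal (real n)" if "\<exists>p. awalk v p w \<and> length p \<le> n"
  proof -
    from that obtain p where p: "awalk v p w" "length p \<le> n" by blast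
    have "graph_dist G v w \<le> ereal (awalk_cost (\<lambda>_. 1) p)"
      unfolding graph_dist_def using p(1) by (rule min_cost_le_walk_cost)
    also have "\<dots> \<le> ereal (real n)" using p(2) by (simp add: cost)
    finally show ?thesis .
  qed
qed

lemma (in pair_graph) pair_graph_graph_power: "pair_graph (graph_power G n)"
proof -
  have sym: "graph_dist G w v \<le> ereal (real n)" if "graph_dist G v w \<le> ereal (real n)" for v w
  proof -
    from that obtain p where "awalk v p w" "length p \<le> n" by (auto simp: graph_dist_le_iff)
    moreover from \<open>awalk v p w\<close> have "\<exists>q. awalk w q v \<and> length q = length p"
    proof (induction p arbitrary: v)
      case Nil
      then show ?case by (auto simp: awalk_Nil_iff)
    next
      case (Cons e es)
      then obtain q where q: "awalk w q (snd e)" "length q = length es"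
        and e: "e \<in> parcs G" "fst e = v"
        by (auto simp: awalk_Cons_iff)
      from e have "(snd e, v) \<in> parcs G"
        using pair_sym_arcs by (cases e) (auto simp: symmetric_def dest: symD)
      then have "awalk (snd e) [(snd e, v)] v"
        by (auto simp: awalk_simps dest: in_arcsD1 in_arcsD2)
      with q show ?case by (intro exI[of _ "q @ [(snd e, v)]"]) auto
    qed
    ultimately show ?thesis by (auto simp: graph_dist_le_iff)
  qed
  have "finite (parcs (graph_power G n))"
    by (rule finite_subset[of _ "pverts G \<times> pverts G"])
       (auto simp: graph_power_def pair_finite_verts)
  then show ?thesis
    by unfold_locales
       (auto simp: graph_power_def symmetric_def pair_finite_verts intro!: symI sym)
qed

end

theory Submission
  imports Defs
begin

text \<open>
  Let \<open>v\<^sub>0, \<dots>, v\<^sub>k\<^sub>-\<^sub>1\<close> be the prescribed vertices. It suffices to find paths with disjoint interiors from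
  each \<open>v\<^sub>i\<close> to \<open>v\<^sub>i\<^sub>+\<^sub>1\<close> (indices modulo \<open>k\<close>) by jumps of length at most \<open>\<lfloor>3k/2\<rfloor>\<close> in a rooted spanning
  tree. The tree is processed from the leaves to the root: each vertex that is not prescribed is given
  to the path that has waited longest among those that have to leave its subtree. Counting shows that
  no path waits longer than the number of paths touching the subtree, up to a correction for prescribed
  vertices whose two neighbours in the cyclic order both lie below them. Two halves of a path coming
  from different children of a vertex can then be joined by a jump of length at most \<open>k\<close> plus the
  number of paths joining these children plus the corrections. A suitable choice of the root makes
  this excess at most \<open>k/2\<close>.

  For the Hamiltonian version, hang a spanning forest on the vertices of the cycle and replace each
  cycle vertex by a traversal of its tree that starts there, jumps by at most 3, and ends at distance
  at most 1 from its start.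
\<close>

section \<open>Rooted trees\<close>

datatype (nodes: 'a) rose = Rose (label: 'a) (kids: "'a rose list")

text \<open>Unlike the set \<open>nodes t\<close>, the list records repetitions, so
  \<open>distinct (labs t)\<close> expresses that no vertex occurs twice in the tree.\<close>

primrec labs :: "'a rose \<Rightarrow> 'a list" where
  "labs (Rose x ts) = x # concat (map labs ts)"

fun linked :: "('a \<Rightarrow> 'a \<Rightarrow> bool) \<Rightarrow> 'a rose \<Rightarrow> bool" where
  "linked E (Rose x ts) \<longleftrightarrow> (\<forall>t\<in>set ts. E x (label t) \<and> linked E t)"

fun subs :: "'a rose \<Rightarrow> 'a rose set" where
  "subs (Rose x ts) = insert (Rose x ts) (\<Union>t\<in>set ts. subs t)"

lemma set_labs [simp]: "set (labs t) = nodes t"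
  by (induction t) auto

lemma finite_nodes [simp]: "finite (nodes t)"
  by (simp flip: set_labs)

lemma label_in_nodes [simp]: "label t \<in> nodes t"
  by (cases t) simp

lemma self_in_subs [simp]: "t \<in> subs t"
  by (cases t) simp

lemma kid_in_subs: "c \<in> set (kids t) \<Longrightarrow> c \<in> subs t"
  by (cases t) (auto intro: bexI[of _ c])

lemma subs_trans: "s \<in> subs t \<Longrightarrow> r \<in> subs s \<Longrightarrow> r \<in> subs t"
  by (induction t) auto

lemma kid_of_sub_in_subs: "s \<in> subs t \<Longrightarrow> c \<in> set (kids s) \<Longrightarrow> c \<in> subs t"
  using kid_in_subs subs_trans by blast

lemma nodes_subs: "s \<in> subs t \<Longrightarrow> nodes s \<subseteq> nodes t"
  by (induction t) auto

lemma size_kid: "c \<in> set (kids t) \<Longrightarrow> size c < size t"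
  by (cases t) (auto dest: size_list_estimation'[of _ _ "size _" size])

lemma size_sub: "s \<in> subs t \<Longrightarrow> size s \<le> size t"
proof (induction t)
  case (Rose x ts)
  show ?case
  proof (cases "s = Rose x ts")
    case False
    with Rose.prems obtain c where c: "c \<in> set ts" "s \<in> subs c" by auto
    with Rose.IH have "size s \<le> size c" by blast
    also have "\<dots> < size (Rose x ts)" using c size_kid[of c "Rose x ts"] by simp
    finally show ?thesis by simp
  qed simp
qed

lemma distinct_labs_sub: "s \<in> subs t \<Longrightarrow> distinct (labs t) \<Longrightarrow> distinct (labs s)"
  by (induction t) (auto simp: distinct_concat_iff)

lemma linked_sub: "s \<in> subs t \<Longrightarrow> linked E t \<Longrightarrow> linked E s"
  by (induction t) auto

lemma distinct_concat_disjoint: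
  assumes "distinct (concat (map f xs))" "x \<in> set xs" "y \<in> set xs" "x \<noteq> y"
  shows "set (f x) \<inter> set (f y) = {}"
proof -
  obtain as bs where "xs = as @ x # bs" using split_list assms(2) by fastforce
  with assms show ?thesis by auto
qed

lemma kids_disjoint:
  assumes "distinct (labs t)" "c \<in> set (kids t)" "d \<in> set (kids t)" "c \<noteq> d"
  shows "nodes c \<inter> nodes d = {}"
proof -
  have "distinct (concat (map labs (kids t)))" using assms(1) by (cases t) simp
  from distinct_concat_disjoint[OF this assms(2-4)] show ?thesis by simp
qed

lemma label_notin_kid:
  "distinct (labs t) \<Longrightarrow> c \<in> set (kids t) \<Longrightarrow> label t \<notin> nodes c"
  by (cases t) auto

text \<open>The ancestor order of the tree, reflexive on its vertices.\<close>

definition below :: "'a rose \<Rightarrow> 'a \<Rightarrow> 'a \<Rightarrow> bool" where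
  "below t u w \<longleftrightarrow> (\<exists>s\<in>subs t. label s = u \<and> w \<in> nodes s)"

lemma below_nodes: "below t u w \<Longrightarrow> u \<in> nodes t \<and> w \<in> nodes t"
  unfolding below_def using nodes_subs label_in_nodes by blast

lemma below_mono: "s \<in> subs t \<Longrightarrow> below s u w \<Longrightarrow> below t u w"
  unfolding below_def using subs_trans by blast

lemma below_kid: "c \<in> set (kids t) \<Longrightarrow> below c u w \<Longrightarrow> below t u w"
  by (rule below_mono[OF kid_in_subs])

lemma sub_cases:
  assumes "s \<in> subs t"
  obtains "s = t" | c where "c \<in> set (kids t)" "s \<in> subs c"
  using assms by (cases t) auto

text \<open>By distinctness, a subtree of \<open>t\<close> whose label lies in \<open>s\<close> is
  itself a subtree of \<open>s\<close>: on the way down from \<open>t\<close> to \<open>s\<close> it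
  can neither be the whole tree nor lie in another child.\<close>

lemma below_restrict:
  assumes "distinct (labs t)" "s \<in> subs t" "u \<in> nodes s" "below t u w"
  shows "below s u w"
  using assms
proof (induction t)
  case (Rose x ts)
  let ?t = "Rose x ts"
  show ?case
  proof (cases "s = ?t")
    case False
    with Rose.prems obtain c where c: "c \<in> set ts" "s \<in> subs c" by auto
    with Rose.prems have uc: "u \<in> nodes c" using nodes_subs by blast
    from Rose.prems obtain r where r: "r \<in> subs ?t" "label r = u" "w \<in> nodes r"
      unfolding below_def by blast
    have "r \<in> subs c"
      using r(1)
    proof (cases rule: sub_cases)
      case 1
      with r uc c Rose.prems label_notin_kid[of ?t c] show ?thesis by simp
    next
      case (2 d)
      then have "u \<in> nodes d" using r nodes_subs label_in_nodes by blast
      with uc c 2 Rose.prems(1) kids_disjoint[of ?t c d] have "c = d" by auto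
      with 2 show ?thesis by simp
    qed
    with r have "below c u w" unfolding below_def by blast
    with Rose c show ?thesis using distinct_labs_sub[of c ?t] kid_in_subs[of c ?t] by simp
  qed (use Rose.prems in simp)
qed

lemma below_antisym:
  assumes "distinct (labs t)" "below t u w" "below t w u"
  shows "u = w"
  using assms
proof (induction t)
  case (Rose x ts)
  let ?t = "Rose x ts"
  from Rose.prems(2) obtain r where r: "r \<in> subs ?t" "label r = u" "w \<in> nodes r"
    unfolding below_def by blast
  show ?case
    using r(1)
  proof (cases rule: sub_cases)
    case 1
    from Rose.prems(3) obtain q where q: "q \<in> subs ?t" "label q = w" "u \<in> nodes q"
      unfolding below_def by blast
    from q(1) show ?thesis
    proof (cases rule: sub_cases)
      case (2 c)
      with q have "u \<in> nodes c" using nodes_subs by blast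
      with 1 r 2 Rose.prems(1) label_notin_kid[of ?t c] show ?thesis by simp
    qed (use 1 r q in simp)
  next
    case (2 c)
    have c: "c \<in> subs ?t" using 2 kid_in_subs by blast
    have "u \<in> nodes c" "w \<in> nodes c" using 2 r nodes_subs label_in_nodes by blast+
    with below_restrict[OF Rose.prems(1) c] Rose.prems have "below c u w" "below c w u" by blast+
    with Rose.IH[of c] 2 distinct_labs_sub[OF c Rose.prems(1)] show ?thesis by simp
  qed
qed

section \<open>Growing and rerooting trees\<close>

lemma reroot_kid:
  assumes sym: "symp E" and t: "t = Rose x (ls @ Rose a as # rs)"
    and "distinct (labs t)" "linked E t"
  defines "t' \<equiv> Rose a (Rose x (ls @ rs) # as)"
  shows "distinct (labs t')" "linked E t'" "nodes t' = nodes t"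
  using assms by (auto dest: sympD)

text \<open>Moving the root edge by edge down to \<open>s\<close> leaves the children of
  \<open>s\<close> intact. So an overloaded pair of children anywhere in the tree becomes such a
  pair at the root.\<close>

lemma reroot_sub:
  assumes "symp E" "distinct (labs t)" "linked E t" "c \<in> set (kids t)" "s \<in> subs c"
  shows "\<exists>t'. distinct (labs t') \<and> linked E t' \<and> nodes t' = nodes t \<and> set (kids s) \<subseteq> set (kids t')"
  using assms(2-)
proof (induction c arbitrary: t)
  case (Rose a as)
  obtain x ts where t: "t = Rose x ts" by (cases t)
  with Rose.prems obtain ls rs where ts: "ts = ls @ Rose a as # rs"
    by (auto dest: split_list)
  let ?t = "Rose a (Rose x (ls @ rs) # as)"
  note * = reroot_kid[OF assms(1) t[unfolded ts] Rose.prems(1,2)]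
  from Rose.prems(4) show ?case
  proof (cases rule: sub_cases)
    case 1
    with * show ?thesis by (intro exI[of _ ?t]) auto
  next
    case (2 d)
    with Rose.IH[of d ?t] * show ?thesis by auto
  qed
qed

lemma attach_leaf:
  assumes "E u w" "u \<in> nodes t" "w \<notin> nodes t" "distinct (labs t)" "linked E t"
  shows "\<exists>t'. distinct (labs t') \<and> linked E t' \<and> nodes t' = insert w (nodes t) \<and> label t' = label t"
  using assms(2-)
proof (induction t)
  case (Rose x ts)
  show ?case
  proof (cases "u = x")
    case True
    with Rose.prems assms(1) show ?thesis
      by (intro exI[of _ "Rose x (Rose w [] # ts)"]) auto
  next
    case False
    with Rose.prems obtain c where c: "c \<in> set ts" "u \<in> nodes c" by auto
    then obtain ls rs where ts: "ts = ls @ c # rs" by (auto dest: split_list)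
    from Rose.IH[OF c] Rose.prems ts obtain c' where c':
      "distinct (labs c')" "linked E c'" "nodes c' = insert w (nodes c)" "label c' = label c"
      by auto
    show ?thesis
      by (rule exI[of _ "Rose x (ls @ c' # rs)"]) (use Rose.prems ts c' in auto)
  qed
qed

text \<open>Starting from single vertices, leaves are attached along edges that leave the covered
  set. Prescribing the roots \<open>cs\<close> serves the Hamiltonian extension; a single root gives
  a spanning tree.\<close>

lemma spanning_forest:
  assumes "finite V"
    and grow: "\<And>S. S \<subset> V \<Longrightarrow> S \<noteq> {} \<Longrightarrow> \<exists>u\<in>S. \<exists>w\<in>V - S. E u w"
    and "distinct cs" "set cs \<subseteq> V" "cs \<noteq> []"
  shows "\<exists>fs. map label fs = cs \<and> distinct (concat (map labs fs)) \<and> (\<forall>t\<in>set fs. linked E t) \<and>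
    (\<Union>t\<in>set fs. nodes t) = V"
proof -
  have "\<exists>fs'. map label fs' = cs \<and> distinct (concat (map labs fs')) \<and> (\<forall>t\<in>set fs'. linked E t) \<and>
      (\<Union>t\<in>set fs'. nodes t) = V"
    if "map label fs = cs" "distinct (concat (map labs fs))" "\<forall>t\<in>set fs. linked E t"
      "(\<Union>t\<in>set fs. nodes t) \<subseteq> V" for fs
    using that
  proof (induction "card (V - (\<Union>t\<in>set fs. nodes t))" arbitrary: fs rule: less_induct)
    case less
    let ?S = "\<Union>t\<in>set fs. nodes t"
    show ?case
    proof (cases "?S = V")
      case False
      have "fs \<noteq> []" using less.prems(1) \<open>cs \<noteq> []\<close> by auto
      then have "label (hd fs) \<in> ?S" by (auto intro: bexI[of _ "hd fs"])
      then have "?S \<noteq> {}" by blast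
      moreover have "?S \<subset> V" using False less.prems(4) by blast
      ultimately obtain u w where uw: "u \<in> ?S" "w \<in> V - ?S" "E u w" using grow by meson
      then obtain t where t: "t \<in> set fs" "u \<in> nodes t" by auto
      then obtain ls rs where fs: "fs = ls @ t # rs" by (auto dest: split_list)
      from attach_leaf[of E u w t] uw t less.prems fs obtain t' where t':
        "distinct (labs t')" "linked E t'" "nodes t' = insert w (nodes t)" "label t' = label t"
        by auto
      let ?fs = "ls @ t' # rs"
      have S': "(\<Union>t\<in>set ?fs. nodes t) = insert w ?S" using t' fs by auto
      have "card (V - insert w ?S) < card (V - ?S)"
        using uw \<open>finite V\<close> by (intro psubset_card_mono) auto
      moreover have "map label ?fs = cs" using less.prems(1) fs t' by simp
      moreover have "distinct (concat (map labs ?fs))" using less.prems(2) fs t' uw by auto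
      moreover have "\<forall>t\<in>set ?fs. linked E t" using less.prems(3) fs t' by auto
      moreover have "(\<Union>t\<in>set ?fs. nodes t) \<subseteq> V" unfolding S' using uw less.prems(4) by blast
      ultimately show ?thesis using less.hyps[of ?fs] unfolding S' by blast
    qed (use less.prems in blast)
  qed
  from this[of "map (\<lambda>c. Rose c []) cs"] show ?thesis
    using assms by (simp add: o_def)
qed

lemma spanning_rose:
  assumes "finite V"
    and grow: "\<And>S. S \<subset> V \<Longrightarrow> S \<noteq> {} \<Longrightarrow> \<exists>u\<in>S. \<exists>w\<in>V - S. E u w"
    and "V \<noteq> {}"
  obtains t where "distinct (labs t)" "linked E t" "nodes t = V"
proof -
  from \<open>V \<noteq> {}\<close> obtain c where "c \<in> V" by blast
  with spanning_forest[of V E "[c]", OF assms(1,2)] obtain t where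
    "distinct (concat (map labs [t]))" "\<forall>t\<in>set [t]. linked E t" "(\<Union>t\<in>set [t]. nodes t) = V"
    by auto
  then show ?thesis by (intro that) auto
qed

section \<open>Balanced rootings\<close>

locale terminals =
  fixes k :: nat and v :: "nat \<Rightarrow> 'a"
  assumes three_le_k: "3 \<le> k" and inj_v: "inj_on v {..<k}"
begin

definition nx :: "nat \<Rightarrow> nat" where
  "nx i = Suc i mod k"

lemma nx_less [simp]: "nx i < k"
  using three_le_k by (simp add: nx_def)

lemma nx_cases: "i < k \<Longrightarrow> nx i = (if Suc i = k then 0 else Suc i)"
  by (auto simp: nx_def)

lemma nx_neq [simp]: "i < k \<Longrightarrow> nx i \<noteq> i" "i < k \<Longrightarrow> i \<noteq> nx i"
  using three_le_k by (auto simp: nx_cases)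

lemma inj_nx: "inj_on nx {..<k}"
  by (auto simp: inj_on_def nx_cases split: if_splits)

lemma nx_eq_iff [simp]: "i < k \<Longrightarrow> j < k \<Longrightarrow> nx i = nx j \<longleftrightarrow> i = j"
  using inj_nx by (auto simp: inj_on_def)

lemma v_eq_iff [simp]: "i < k \<Longrightarrow> j < k \<Longrightarrow> v i = v j \<longleftrightarrow> i = j"
  using inj_v by (auto simp: inj_on_def)

lemma ex_nx: "j < k \<Longrightarrow> \<exists>i<k. nx i = j"
proof -
  have "nx ` {..<k} = {..<k}" by (rule endo_inj_surj[OF _ _ inj_nx]) auto
  then show "j < k \<Longrightarrow> \<exists>i<k. nx i = j" by (metis imageE lessThan_iff)
qed

definition joins :: "'a set \<Rightarrow> 'a set \<Rightarrow> nat set" where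
  "joins A B = {i. i < k \<and> (v i \<in> A \<and> v (nx i) \<in> B \<or> v i \<in> B \<and> v (nx i) \<in> A)}"

text \<open>Path \<open>i\<close> runs from \<open>v i\<close> to \<open>v (nx i)\<close>. At a terminal \<open>v (nx i)\<close> with \<open>i\<close> in the following set,
  two paths come to an end and none sets out upwards.\<close>

definition tops :: "'a rose \<Rightarrow> nat set" where
  "tops t = {i. i < k \<and> below t (v (nx i)) (v i) \<and> below t (v (nx i)) (v (nx (nx i)))}"

text \<open>Bounds by how much the waits in two subtrees together can exceed \<open>k\<close>: a
  path joining them is counted on both sides, and each top adds one.\<close>

definition load :: "'a rose \<Rightarrow> 'a rose \<Rightarrow> nat" where
  "load s t = card (joins (nodes s) (nodes t)) + card (tops s) + card (tops t)"

text \<open>The bound \<open>k div 2\<close> is what the jump length \<open>(3 * k) div 2\<close>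
  leaves beyond \<open>k\<close>.\<close>

definition balanced :: "'a rose \<Rightarrow> bool" where
  "balanced t \<longleftrightarrow>
    (\<forall>s\<in>subs t. \<forall>c\<in>set (kids s). \<forall>d\<in>set (kids s). c \<noteq> d \<longrightarrow> load c d \<le> k div 2)"

lemma load_commute: "load s t = load t s"
proof -
  have "joins (nodes s) (nodes t) = joins (nodes t) (nodes s)" by (auto simp: joins_def)
  then show ?thesis by (simp add: load_def)
qed

lemma joins_subset: "joins A B \<subseteq> {..<k}"
  by (auto simp: joins_def)

lemma tops_subset: "tops t \<subseteq> {..<k}"
  by (auto simp: tops_def)

lemma finite_joins [simp]: "finite (joins A B)"
  using finite_subset[OF joins_subset] by blast

lemma finite_tops [simp]: "finite (tops t)"
  using finite_subset[OF tops_subset] by blast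

lemma tops_nodes:
  "i \<in> tops t \<Longrightarrow> v i \<in> nodes t \<and> v (nx i) \<in> nodes t \<and> v (nx (nx i)) \<in> nodes t"
  by (auto simp: tops_def dest: below_nodes)

lemma tops_mono: "s \<in> subs t \<Longrightarrow> tops s \<subseteq> tops t"
  by (auto simp: tops_def intro: below_mono)

text \<open>If \<open>i\<close> and \<open>nx i\<close> were both tops, \<open>v (nx i)\<close> and
  \<open>v (nx (nx i))\<close> would be ancestors of each other. Hence at most half of the indices
  are tops.\<close>

lemma tops_nx_disjoint:
  assumes "distinct (labs t)"
  shows "tops t \<inter> nx ` tops t = {}"
  using below_antisym[OF assms] by (fastforce simp: tops_def)

lemma card_nx_tops: "card (nx ` tops t) = card (tops t)"
  using inj_on_subset[OF inj_nx tops_subset] by (rule card_image)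

lemma card_tops_le:
  assumes "distinct (labs t)"
  shows "card (tops t) \<le> k div 2"
proof -
  have "card (tops t) + card (nx ` tops t) = card (tops t \<union> nx ` tops t)"
    using tops_nx_disjoint[OF assms] by (simp add: card_Un_disjoint)
  also have "\<dots> \<le> card {..<k}"
    using tops_subset by (intro card_mono) auto
  finally show ?thesis by (simp add: card_nx_tops)
qed

text \<open>The paths counted by the two joins, the tops of \<open>A\<close> and \<open>B\<close>, and the successors of the tops
  of \<open>C\<close> and \<open>D\<close> are pairwise disjoint sets of indices.\<close>

lemma load_sum_le:
  assumes t: "distinct (labs t)" and AB: "A \<in> set (kids t)" "B \<in> set (kids t)" "A \<noteq> B"
    and C: "C \<in> subs t" and D: "D \<in> subs t"
    and disj: "nodes C \<inter> nodes D = {}" "nodes A \<inter> nodes C = {}" "nodes A \<inter> nodes D = {}"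
  shows "load A B + load C D \<le> k"
proof -
  note dAB = kids_disjoint[OF t AB]
  let ?J1 = "joins (nodes A) (nodes B)" and ?J2 = "joins (nodes C) (nodes D)"
  \<comment> \<open>Each top is represented by one of the two paths ending at it: for
    \<open>A\<close> and \<open>B\<close> by the arriving path, for \<open>C\<close> and
    \<open>D\<close> by the one setting out.\<close>
  let ?T1 = "tops A \<union> tops B" and ?T2 = "nx ` (tops C \<union> tops D)"
  \<comment> \<open>\<open>B\<close> may meet or equal \<open>C\<close> or \<open>D\<close>, so its
    tops are separated by the ancestor order of \<open>t\<close>: their paths rise from start to
    end, those chosen for \<open>C\<close> and \<open>D\<close> descend, and those joining
    \<open>C\<close> and \<open>D\<close> have incomparable ends.\<close>
  have down: "below t (v (nx i)) (v i)" if "i \<in> tops B" for i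
    using that below_kid[OF AB(2)] by (auto simp: tops_def)
  have up: "below t (v (nx i)) (v (nx (nx i)))" if "i \<in> tops C \<union> tops D" for i
    using that below_mono[OF C] below_mono[OF D] by (auto simp: tops_def)
  have incomparable: "\<not> below t u w" if "u \<in> nodes C \<and> w \<in> nodes D \<or> u \<in> nodes D \<and> w \<in> nodes C" for u w
  proof
    assume "below t u w"
    with that below_restrict[OF t C, of u w] below_restrict[OF t D, of u w]
    have "below C u w \<and> w \<in> nodes D \<or> below D u w \<and> w \<in> nodes C" by blast
    with below_nodes[of C u w] below_nodes[of D u w] disj(1) show False by blast
  qed
  have "?J1 \<inter> ?T1 = {}" using dAB by (auto simp: joins_def dest!: tops_nodes)
  moreover have "?J1 \<inter> ?T2 = {}" using disj by (auto simp: joins_def dest!: tops_nodes)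
  moreover have "?J2 \<inter> ?T2 = {}" using disj by (auto simp: joins_def dest!: tops_nodes)
  moreover have "?J1 \<inter> ?J2 = {}" using disj by (auto simp: joins_def)
  moreover have "?J2 \<inter> ?T1 = {}"
  proof -
    have False if "i \<in> ?J2" "i \<in> tops A" for i
      using that disj by (auto simp: joins_def dest!: tops_nodes)
    moreover have False if "i \<in> ?J2" "i \<in> tops B" for i
      using that down[of i] incomparable by (auto simp: joins_def)
    ultimately show ?thesis by blast
  qed
  moreover have "?T1 \<inter> ?T2 = {}"
  proof -
    have False if "nx l \<in> tops A" "l \<in> tops C \<union> tops D" for l
      using that disj by (auto dest!: tops_nodes)
    moreover have False if "nx l \<in> tops B" "l \<in> tops C \<union> tops D" for l
      using below_antisym[OF t down[of "nx l"] up[of l]] that by auto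
    ultimately show ?thesis by blast
  qed
  ultimately have "card (?J1 \<union> ?J2 \<union> ?T1 \<union> ?T2) = card ?J1 + card ?J2 + card ?T1 + card ?T2"
    by (subst card_Un_disjoint; (auto)[])+
  moreover have "card ?T1 = card (tops A) + card (tops B)"
    using dAB by (intro card_Un_disjoint) (auto dest!: tops_nodes)
  moreover have "card ?T2 = card (tops C) + card (tops D)"
  proof -
    have "card ?T2 = card (tops C \<union> tops D)"
      by (rule card_image[OF inj_on_subset[OF inj_nx]]) (use tops_subset in blast)
    also have "\<dots> = card (tops C) + card (tops D)"
      using disj(1) by (intro card_Un_disjoint) (auto dest!: tops_nodes)
    finally show ?thesis .
  qed
  moreover have "card (?J1 \<union> ?J2 \<union> ?T1 \<union> ?T2) \<le> card {..<k}"
    by (rule card_mono) (use tops_subset joins_subset in auto)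
  ultimately show ?thesis by (simp add: load_def)
qed

lemma balanced_rerooting:
  assumes E: "symp E" and "distinct (labs t)" "linked E t"
  shows "\<exists>t'. distinct (labs t') \<and> linked E t' \<and> nodes t' = nodes t \<and> balanced t'"
proof -
  txt \<open>Given an overloaded pair of children of the root, move the root to one of them. By
    \<open>load_sum_le\<close>, a new overloaded pair cannot lie on the old root's side.\<close>
  have step: "\<exists>t'. distinct (labs t') \<and> linked E t' \<and> nodes t' = nodes t \<and> balanced t'"
    if "distinct (labs t)" "linked E t" "A \<in> set (kids t)" "B \<in> set (kids t)" "A \<noteq> B"
      "k div 2 < load A B" for t A B
    using that
  proof (induction "size A" arbitrary: t A B rule: less_induct)
    case less
    obtain x ts where t0: "t = Rose x ts" by (cases t)
    obtain a as where A: "A = Rose a as" by (cases A)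
    from less.prems(3) t0 A obtain ls rs where "ts = ls @ Rose a as # rs"
      by (auto dest: split_list)
    with t0 have t: "t = Rose x (ls @ Rose a as # rs)" by simp
    let ?X = "Rose x (ls @ rs)"
    let ?t = "Rose a (?X # as)"
    note re = reroot_kid[OF E t less.prems(1,2)]
    show ?case
    proof (cases "balanced ?t")
      case True
      with re show ?thesis by (intro exI[of _ ?t]) simp
    next
      case False
      then obtain Z C D where Z: "Z \<in> subs ?t" and CD: "C \<in> set (kids Z)" "D \<in> set (kids Z)"
        "C \<noteq> D" "k div 2 < load C D"
        unfolding balanced_def not_le[symmetric] by blast
      have "Z \<notin> subs ?X"
      proof
        assume ZX: "Z \<in> subs ?X"
        have sub: "c \<in> subs t \<and> nodes A \<inter> nodes c = {}" if "c \<in> set (kids Z)" for c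
        proof
          show "c \<in> subs t" using ZX
          proof (cases rule: sub_cases)
            case 1
            with that show ?thesis unfolding t by (intro kid_in_subs) auto
          next
            case (2 d)
            then have "d \<in> subs t" unfolding t by (intro kid_in_subs) auto
            with 2 that kid_of_sub_in_subs subs_trans show ?thesis by blast
          qed
          have "nodes c \<subseteq> nodes ?X" using that ZX kid_of_sub_in_subs nodes_subs by blast
          moreover have "nodes A \<inter> nodes ?X = {}"
            using less.prems(1) unfolding t A by auto
          ultimately show "nodes A \<inter> nodes c = {}" by blast
        qed
        have "distinct (labs Z)"
          using distinct_labs_sub[OF Z re(1)] .
        from kids_disjoint[OF this CD(1-3)] have "nodes C \<inter> nodes D = {}" .
        with load_sum_le[OF less.prems(1,3-5)] sub CD have "load A B + load C D \<le> k" by auto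
        with CD less.prems(6) show False by linarith
      qed
      \<comment> \<open>If \<open>Z\<close> is the new root, one of the pair differs from
        \<open>?X\<close> and is a child of \<open>A\<close>; otherwise \<open>Z\<close> lies inside
        a child of \<open>A\<close>. Since \<open>load\<close> is symmetric, the smaller tree can be
        put first, and the induction descends.\<close>
      have "\<exists>C D. C \<in> set (kids Z) \<and> D \<in> set (kids Z) \<and> C \<noteq> D \<and> k div 2 < load C D \<and> size C < size A"
        using Z
      proof (cases rule: sub_cases)
        case 1
        have "size c < size A" if "c \<in> set (kids Z)" "c \<noteq> ?X" for c
          using that 1 size_kid[of c A] A by auto
        with CD show ?thesis by (metis load_commute)
      next
        case (2 c)
        with \<open>Z \<notin> subs ?X\<close> have "c \<in> set (kids A)" using A by auto
        then have "size C < size A" using size_kid size_sub[OF 2(2)] CD(1)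
          by (meson order_less_le_trans order_less_trans)
        with CD show ?thesis by blast
      qed
      then obtain C D where CD: "C \<in> set (kids Z)" "D \<in> set (kids Z)" "C \<noteq> D"
        "k div 2 < load C D" "size C < size A" by blast
      \<comment> \<open>Rerooting at \<open>Z\<close> brings the pair to the root, as the induction
        hypothesis requires.\<close>
      obtain t' where t': "distinct (labs t')" "linked E t'" "nodes t' = nodes t"
        "set (kids Z) \<subseteq> set (kids t')"
        using Z
      proof (cases rule: sub_cases)
        case 1
        with re that[of ?t] show ?thesis by simp
      next
        case (2 c)
        from reroot_sub[OF E re(1,2) 2] re(3) that show ?thesis by auto
      qed
      with less.hyps[of C t' D] CD show ?thesis by auto
    qed
  qed
  show ?thesis
  proof (cases "balanced t")
    case False
    then obtain Z C D where Z: "Z \<in> subs t" and CD: "C \<in> set (kids Z)" "D \<in> set (kids Z)"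
      "C \<noteq> D" "k div 2 < load C D"
      unfolding balanced_def not_le[symmetric] by blast
    from Z show ?thesis
    proof (cases rule: sub_cases)
      case 1
      with step[OF assms(2,3)] CD show ?thesis by auto
    next
      case (2 c)
      from reroot_sub[OF assms 2] obtain t' where t': "distinct (labs t')" "linked E t'"
        "nodes t' = nodes t" "set (kids Z) \<subseteq> set (kids t')" by blast
      with step[OF t'(1,2)] CD show ?thesis by (metis subset_iff)
    qed
  qed (use assms in blast)
qed

end

section \<open>Routing the paths up the tree\<close>

definition near :: "('a \<Rightarrow> 'a \<Rightarrow> bool) \<Rightarrow> nat \<Rightarrow> 'a \<Rightarrow> 'a \<Rightarrow> bool" where
  "near E n x y \<longleftrightarrow> (\<exists>m\<le>n. (E ^^ m) x y)"

lemma near_refl [simp]: "near E n x x"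
  unfolding near_def by (rule exI[of _ 0]) simp

lemma near_edge: "E x y \<Longrightarrow> near E 1 x y"
  unfolding near_def by (rule exI[of _ 1]) auto

lemma near_mono: "near E m x y \<Longrightarrow> m \<le> n \<Longrightarrow> near E n x y"
  unfolding near_def using le_trans by blast

lemma near_trans: "near E m x y \<Longrightarrow> near E n y z \<Longrightarrow> near E (m + n) x z"
  unfolding near_def by (metis add_mono relcomppI relpowp_add)

lemma near_sym:
  assumes "symp E" "near E n x y"
  shows "near E n y x"
proof -
  have "(E ^^ m) x y \<Longrightarrow> (E ^^ m) y x" for m
  proof (induction m arbitrary: y)
    case (Suc m)
    then obtain z where "(E ^^ m) x z" "E z y" by (auto elim: relcomppE)
    with Suc.IH assms(1) show ?case by (intro relpowp_Suc_I2) (auto dest: sympD)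
  qed simp
  with assms(2) show ?thesis unfolding near_def by blast
qed

text \<open>Only the vertices after the start must lie in \<open>U\<close>: a path starts at a
  terminal, while the sets of inner vertices contain no terminals.\<close>

definition reach :: "('a \<Rightarrow> 'a \<Rightarrow> bool) \<Rightarrow> nat \<Rightarrow> 'a set \<Rightarrow> 'a \<Rightarrow> 'a \<Rightarrow> bool" where
  "reach E n U = (\<lambda>x y. near E n x y \<and> y \<in> U)\<^sup>*\<^sup>*"

lemma reach_refl [simp]: "reach E n U x x"
  by (simp add: reach_def)

lemma reach_step: "reach E n U x y \<Longrightarrow> near E n y z \<Longrightarrow> z \<in> U \<Longrightarrow> reach E n U x z"
  by (auto simp: reach_def intro: rtranclp.rtrancl_into_rtrancl)

lemma reach_mono: "reach E n U x y \<Longrightarrow> U \<subseteq> U' \<Longrightarrow> reach E n U' x y"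
  unfolding reach_def by (erule rtranclp_mono[THEN predicate2D, rotated]) auto

locale routing = terminals k v for k :: nat and v :: "nat \<Rightarrow> 'a" +
  fixes E :: "'a \<Rightarrow> 'a \<Rightarrow> bool"
  assumes symp_E: "symp E"
begin

abbreviation D :: nat where
  "D \<equiv> (3 * k) div 2"

lemma D_eq: "D = k + k div 2"
  by presburger

text \<open>For the vertex set of a subtree, \<open>up\<close> collects the paths that have to leave
  it, \<open>full\<close> those that are to be completed inside it, and \<open>touch\<close>
  both.\<close>

definition touch :: "'a set \<Rightarrow> nat set" where
  "touch S = {i. i < k \<and> (v i \<in> S \<or> v (nx i) \<in> S)}"

definition up :: "'a set \<Rightarrow> nat set" where
  "up S = {i. i < k \<and> (v i \<in> S) \<noteq> (v (nx i) \<in> S)}"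

definition full :: "'a set \<Rightarrow> nat set" where
  "full S = {i. i < k \<and> v i \<in> S \<and> v (nx i) \<in> S}"

text \<open>The ends may lie below different children of a vertex, so the two halves are routed
  separately and joined by one last jump.\<close>

definition conn :: "'a set \<Rightarrow> nat \<Rightarrow> bool" where
  "conn U i \<longleftrightarrow> (\<exists>z z'. reach E D U (v i) z \<and> reach E D U (v (nx i)) z' \<and> near E D z z')"

text \<open>The part of path \<open>i\<close> inside \<open>t\<close> has been routed up to a vertex \<open>z\<close> that is within \<open>n\<close> of the root.\<close>

definition held :: "'a rose \<Rightarrow> 'a set \<Rightarrow> nat \<Rightarrow> nat \<Rightarrow> bool" where
  "held t U n i \<longleftrightarrow>
    (\<exists>a z. a \<in> {v i, v (nx i)} \<inter> nodes t \<and> reach E D U a z \<and> near E n z (label t))"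

text \<open>\<open>U i\<close> is the set of inner vertices given to path \<open>i\<close>, and \<open>w i\<close> the distance that it has
  waited. The last clause is the invariant that longest-waiting-first preserves.\<close>

definition schedule :: "'a rose \<Rightarrow> (nat \<Rightarrow> 'a set) \<Rightarrow> (nat \<Rightarrow> nat) \<Rightarrow> bool" where
  "schedule t U w \<longleftrightarrow>
    (\<forall>i. U i \<subseteq> nodes t - v ` {..<k}) \<and> (\<forall>i j. i \<noteq> j \<longrightarrow> U i \<inter> U j = {}) \<and>
    (\<forall>i\<in>full (nodes t). conn (U i) i) \<and> (\<forall>i\<in>up (nodes t). held t (U i) (w i) i) \<and>
    (\<forall>j\<ge>1. {i \<in> up (nodes t). j \<le> w i} \<noteq> {} \<longrightarrow>
      card {i \<in> up (nodes t). j \<le> w i} + j \<le> card (touch (nodes t)) + card (tops t))"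

lemma finite_touch [simp]: "finite (touch S)"
  by (simp add: touch_def)

lemma finite_up [simp]: "finite (up S)"
  by (simp add: up_def)

lemma card_touch_le: "card (touch S) \<le> k"
proof -
  have "card (touch S) \<le> card {..<k}" by (rule card_mono) (auto simp: touch_def)
  then show ?thesis by simp
qed

lemma up_subset_touch: "up S \<subseteq> touch S"
  by (auto simp: up_def touch_def)

lemma touch_mono: "S \<subseteq> S' \<Longrightarrow> touch S \<subseteq> touch S'"
  by (auto simp: touch_def)

lemma conn_mono: "conn U i \<Longrightarrow> U \<subseteq> U' \<Longrightarrow> conn U' i"
  unfolding conn_def using reach_mono by metis

lemma held_mono: "held t U n i \<Longrightarrow> U \<subseteq> U' \<Longrightarrow> held t U' n i"
  unfolding held_def using reach_mono by metis

text \<open>Take \<open>j = w i\<close> in the invariant: path \<open>i\<close> itself is counted,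
  so the cardinality is at least 1. If \<open>w i = 0\<close>, it suffices that path
  \<open>i\<close> touches the subtree.\<close>

lemma wait_le:
  assumes "schedule t U w" "i \<in> up (nodes t)"
  shows "Suc (w i) \<le> card (touch (nodes t)) + card (tops t)"
proof (cases "w i = 0")
  case True
  have "card (touch (nodes t)) > 0" using assms(2) up_subset_touch by (auto simp: card_gt_0_iff)
  with True show ?thesis by simp
next
  case False
  let ?N = "{i' \<in> up (nodes t). w i \<le> w i'}"
  have i: "i \<in> ?N" using assms(2) by simp
  then have "card ?N > 0" by (auto simp: card_gt_0_iff)
  moreover have "card ?N + w i \<le> card (touch (nodes t)) + card (tops t)"
  proof -
    have "1 \<le> w i" "?N \<noteq> {}" using i False by auto
    with assms(1) show ?thesis unfolding schedule_def by blast
  qed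
  ultimately show ?thesis by simp
qed

text \<open>Inclusion-exclusion: at most \<open>k\<close> paths touch the union, and a path touching
  both of the disjoint subtrees joins them.\<close>

lemma touch_sum_le:
  assumes "nodes c \<inter> nodes d = {}" "load c d \<le> k div 2"
  shows "card (touch (nodes c)) + card (tops c) + (card (touch (nodes d)) + card (tops d)) \<le> D"
proof -
  let ?C = "touch (nodes c)" and ?D = "touch (nodes d)"
  have "card ?C + card ?D = card (?C \<union> ?D) + card (?C \<inter> ?D)"
    by (rule card_Un_Int) simp_all
  moreover have "?C \<union> ?D = touch (nodes c \<union> nodes d)"
    by (auto simp: touch_def)
  moreover have "card (?C \<inter> ?D) \<le> card (joins (nodes c) (nodes d))"
    using assms(1) by (intro card_mono) (auto simp: touch_def joins_def)
  ultimately show ?thesis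
    using assms(2) card_touch_le[of "nodes c \<union> nodes d"] by (simp add: load_def D_eq)
qed

text \<open>Induction from the leaves to the root. Merging the schedules of the children lets the
  waits grow by one, which may exceed the invariant by one. If the root is a terminal, the count
  itself saves the one; otherwise the root is handed to a path of maximal wait.\<close>

lemma ex_schedule:
  assumes "distinct (labs t)" "linked E t" "balanced t"
  shows "\<exists>U w. schedule t U w"
  using assms
proof (induction t)
  case (Rose x ts)
  let ?t = "Rose x ts"
  let ?S = "nodes ?t" and ?VS = "v ` {..<k}"
  note dist = Rose.prems(1)
  have kid: "c \<in> subs ?t" if "c \<in> set ts" for c using that kid_in_subs[of c ?t] by simp
  have x_notin: "x \<notin> nodes c" if "c \<in> set ts" for c using that dist by auto
  have disj: "nodes c \<inter> nodes d = {}" if "c \<in> set ts" "d \<in> set ts" "c \<noteq> d" for c d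
    using kids_disjoint[OF dist] that by simp
  have "\<forall>c\<in>set ts. \<exists>U w. schedule c U w"
  proof
    fix c assume c: "c \<in> set ts"
    have "balanced c" using Rose.prems(3) subs_trans[OF kid[OF c]] unfolding balanced_def by blast
    with Rose.IH[OF c] kid[OF c] distinct_labs_sub linked_sub Rose.prems show "\<exists>U w. schedule c U w" by blast
  qed
  then obtain U W where UW: "\<And>c. c \<in> set ts \<Longrightarrow> schedule c (U c) (W c)" by metis
  txt \<open>\<open>V\<close> and \<open>w\<close> describe the state before \<open>x\<close> itself is given to a path.\<close>
  define V where "V i = (\<Union>c\<in>set ts. U c i)" for i
  \<comment> \<open>A path leaving \<open>?S\<close> has only one end there, so at most one child
    qualifies.\<close>
  define child where "child i = (SOME c. c \<in> set ts \<and> i \<in> up (nodes c))" for i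
  define w where "w i = (if x \<in> {v i, v (nx i)} then 0 else Suc (W (child i) i))" for i
  have U_sub: "U c i \<subseteq> nodes c - ?VS" if "c \<in> set ts" for c i
    using UW[OF that] unfolding schedule_def by blast
  have V_sub: "V i \<subseteq> ?S - {x} - ?VS" for i
    using U_sub x_notin unfolding V_def by fastforce
  have V_disj: "V i \<inter> V j = {}" if "i \<noteq> j" for i j
  proof -
    have "U c i \<inter> U d j = {}" if "c \<in> set ts" "d \<in> set ts" for c d
    proof (cases "c = d")
      case True
      with UW[OF that(1)] \<open>i \<noteq> j\<close> show ?thesis unfolding schedule_def by blast
    next
      case False
      with disj[OF that] U_sub[OF that(1), of i] U_sub[OF that(2), of j] show ?thesis by blast
    qed
    then show ?thesis unfolding V_def by blast
  qed
  have arrive: "\<exists>z. reach E D (V i) a z \<and> near E (Suc (W c i)) z x"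
    if c: "c \<in> set ts" and i: "i \<in> up (nodes c)" and a: "a \<in> {v i, v (nx i)}" "a \<in> nodes c" for c i a
  proof -
    from UW[OF c] i have "held c (U c i) (W c i) i" unfolding schedule_def by blast
    then obtain b z where b: "b \<in> {v i, v (nx i)}" "b \<in> nodes c" "reach E D (U c i) b z"
      "near E (W c i) z (label c)" unfolding held_def by blast
    with i a have "b = a" by (auto simp: up_def)
    with b reach_mono[of E D "U c i" a z "V i"] c have "reach E D (V i) a z"
      unfolding V_def by blast
    moreover have "E x (label c)" using Rose.prems(2) c by simp
    with symp_E have "E (label c) x" by (rule sympD)
    with near_trans[OF b(4) near_edge] have "near E (Suc (W c i)) z x" by simp
    ultimately show ?thesis by blast
  qed
  have full: "conn (V i) i" if i: "i \<in> full ?S" for i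
  proof -
    have ik: "i < k" using i by (simp add: full_def)
    have one: "\<exists>z. reach E D (V i) a z \<and> near E D z x"
      if "{v i, v (nx i)} = {a, x}" "a \<noteq> x" for a
    proof -
      have "a \<in> {v i, v (nx i)}" by (simp add: that(1))
      with i have "a \<in> ?S" unfolding full_def by blast
      with that(2) obtain c where c: "c \<in> set ts" "a \<in> nodes c" by auto
      have "i \<in> up (nodes c)" using that c x_notin ik unfolding up_def by (auto simp: doubleton_eq_iff)
      with arrive[OF c(1) _ _ c(2)] that obtain z where
        z: "reach E D (V i) a z" "near E (Suc (W c i)) z x" by blast
      \<comment> \<open>The other end is \<open>x\<close> itself, and the crude bounds
        \<open>k\<close> for touching paths and \<open>k div 2\<close> for tops already allow a
        single jump to it.\<close>
      have "Suc (W c i) \<le> D"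
        using wait_le[OF UW[OF c(1)] \<open>i \<in> up (nodes c)\<close>] card_touch_le[of "nodes c"]
          card_tops_le[of c] distinct_labs_sub[OF kid[OF c(1)] dist] by (simp add: D_eq)
      with z(2) have "near E D z x" by (rule near_mono)
      with z(1) show ?thesis by blast
    qed
    have "v i \<noteq> v (nx i)" using ik by simp
    then consider "v i = x" "v (nx i) \<noteq> x" | "v i \<noteq> x" "v (nx i) = x" | "v i \<noteq> x" "v (nx i) \<noteq> x"
      by blast
    then show ?thesis
    proof cases
      case 1
      with one[of "v (nx i)"] obtain z where "reach E D (V i) (v (nx i)) z" "near E D z x" by auto
      with 1 near_sym[OF symp_E] show ?thesis unfolding conn_def by (intro exI[of _ x] exI[of _ z]) simp
    next
      case 2
      with one[of "v i"] obtain z where "reach E D (V i) (v i) z" "near E D z x" by auto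
      with 2 show ?thesis unfolding conn_def by (intro exI[of _ z] exI[of _ x]) simp
    next
      case 3
      with i obtain c d where cd: "c \<in> set ts" "v i \<in> nodes c" "d \<in> set ts" "v (nx i) \<in> nodes d"
        by (auto simp: full_def)
      show ?thesis
      proof (cases "c = d")
        case True
        with cd ik have "i \<in> full (nodes c)" by (simp add: full_def)
        with UW[OF cd(1)] have "conn (U c i) i" unfolding schedule_def by blast
        then show ?thesis using cd(1) by (elim conn_mono) (auto simp: V_def)
      next
        case False
        note dcd = disj[OF cd(1,3) False]
        with cd ik have up: "i \<in> up (nodes c)" "i \<in> up (nodes d)" by (auto simp: up_def)
        obtain z where z: "reach E D (V i) (v i) z" "near E (Suc (W c i)) z x"
          using arrive[OF cd(1) up(1) _ cd(2)] by auto
        obtain z' where z': "reach E D (V i) (v (nx i)) z'" "near E (Suc (W d i)) z' x"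
          using arrive[OF cd(3) up(2) _ cd(4)] by auto
        \<comment> \<open>The joining jump is measured through \<open>x\<close>; balance keeps the
          sum of both distances within \<open>D\<close>.\<close>
        have "load c d \<le> k div 2"
          using Rose.prems(3) cd False unfolding balanced_def by (metis rose.sel(2) self_in_subs)
        from touch_sum_le[OF dcd this] wait_le[OF UW[OF cd(1)] up(1)] wait_le[OF UW[OF cd(3)] up(2)]
        have "Suc (W c i) + Suc (W d i) \<le> D" by linarith
        with near_trans[OF z(2) near_sym[OF symp_E z'(2)]] have "near E D z z'"
          by (rule near_mono)
        with z(1) z'(1) show ?thesis unfolding conn_def by blast
      qed
    qed
  qed
  have child: "child i \<in> set ts \<and> i \<in> up (nodes (child i))"
    if "i \<in> up ?S" "x \<notin> {v i, v (nx i)}" for i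
  proof -
    from that obtain c where "c \<in> set ts" "i \<in> up (nodes c)" by (auto simp: up_def)
    then show ?thesis unfolding child_def by (metis (mono_tags, lifting) someI_ex)
  qed
  have held: "held ?t (V i) (w i) i" if i: "i \<in> up ?S" for i
  proof (cases "x \<in> {v i, v (nx i)}")
    case True
    then show ?thesis unfolding held_def by (intro exI[of _ x]) auto
  next
    case False
    from child[OF i False] obtain a where a: "a \<in> {v i, v (nx i)}" "a \<in> nodes (child i)"
      and c: "child i \<in> set ts" "i \<in> up (nodes (child i))" by (auto simp: up_def)
    from arrive[OF c a] obtain z where "reach E D (V i) a z" "near E (Suc (W (child i) i)) z x"
      by blast
    with a c(1) False show ?thesis unfolding held_def w_def by auto
  qed
  define N where "N j = {i \<in> up ?S. j \<le> w i}" for j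
  define Q where "Q = card (touch ?S) + card (tops ?t)"
  have finite_N: "finite (N j)" for j by (simp add: N_def)
  \<comment> \<open>Fix the child \<open>c\<close> of one path in \<open>N j\<close>. Every path in
    \<open>N j\<close> either has waited at least \<open>j - 1\<close> in \<open>c\<close> or
    touches \<open>?S\<close> but neither \<open>c\<close> nor \<open>x\<close>. Passing from
    \<open>j - 1\<close> to \<open>j\<close> costs the one in \<open>Suc Q\<close>.\<close>
  have bound: "card (N j) + j \<le> (if x \<in> ?VS then Q else Suc Q)" if "1 \<le> j" "N j \<noteq> {}" for j
  proof -
    from that(2) obtain i where i: "i \<in> up ?S" "j \<le> w i" by (auto simp: N_def)
    define c where "c = child i"
    have "x \<notin> {v i, v (nx i)}" using i that(1) by (auto simp: w_def split: if_splits)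
    with child i have c: "c \<in> set ts" "i \<in> up (nodes c)" "j \<le> Suc (W c i)"
      by (auto simp: c_def w_def)
    let ?T = "touch (nodes c)"
    let ?M = "{i \<in> up (nodes c). j - 1 \<le> W c i}"
    let ?X = "{i. i < k \<and> x \<in> {v i, v (nx i)}}"
    have i_M: "i \<in> ?M" using c by simp
    \<comment> \<open>The invariant starts at 1, so for \<open>j = 1\<close> the count is bounded
      directly by the paths touching \<open>c\<close>.\<close>
    have M: "card ?M + (j - 1) \<le> card ?T + card (tops c)"
    proof (cases "j = 1")
      case True
      have "card ?M \<le> card ?T" using up_subset_touch by (intro card_mono) auto
      with True show ?thesis by simp
    next
      case False
      with that(1) have "1 \<le> j - 1" by simp
      with UW[OF c(1)] i_M show ?thesis unfolding schedule_def by blast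
    qed
    have T_sub: "?T \<subseteq> touch ?S" using c(1) by (intro touch_mono) auto
    have tops_sub: "tops c \<subseteq> tops ?t" using tops_mono[OF kid[OF c(1)]] .
    have "N j \<subseteq> ?M \<union> (touch ?S - ?T - ?X)"
    proof
      fix l assume "l \<in> N j"
      then have l: "l \<in> up ?S" "j \<le> w l" by (auto simp: N_def)
      with that(1) have lx: "x \<notin> {v l, v (nx l)}" by (auto simp: w_def split: if_splits)
      note cl = child[OF l(1) lx]
      show "l \<in> ?M \<union> (touch ?S - ?T - ?X)"
      proof (cases "child l = c")
        case True
        with cl l lx show ?thesis by (auto simp: w_def)
      next
        case False
        with disj[of "child l" c] cl c(1) have dj: "nodes (child l) \<inter> nodes c = {}" by blast
        have "l \<notin> ?T"
        proof
          assume "l \<in> ?T"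
          with cl dj have "v l \<in> nodes (child l) \<union> nodes c" "v (nx l) \<in> nodes (child l) \<union> nodes c"
            by (auto simp: up_def touch_def)
          with cl c(1) have "v l \<in> ?S" "v (nx l) \<in> ?S" by auto
          with l(1) show False by (simp add: up_def)
        qed
        with l(1) lx up_subset_touch show ?thesis by blast
      qed
    qed
    then have "card (N j) \<le> card (?M \<union> (touch ?S - ?T - ?X))" by (intro card_mono) auto
    also have "\<dots> \<le> card ?M + card (touch ?S - ?T - ?X)" by (rule card_Un_le)
    finally have N_le: "card (N j) \<le> card ?M + card (touch ?S - ?T - ?X)" .
    have tops_le: "card (tops c) \<le> card (tops ?t)" using tops_sub by (intro card_mono) auto
    have T_card: "card (touch ?S - ?T) + card ?T = card (touch ?S)"
      using T_sub by (metis card_Diff_subset card_mono finite_touch le_add_diff_inverse2 finite_subset)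
    have diff_le: "card (touch ?S - ?T - ?X) \<le> card (touch ?S - ?T)" by (intro card_mono) auto
    show ?thesis
    proof (cases "x \<in> ?VS")
      case False
      then show ?thesis using N_le M T_card diff_le tops_le that(1) by (simp add: Q_def)
    next
      case True
      then obtain m where m: "m < k" "x = v m" by auto
      with ex_nx obtain l where l: "l < k" "nx l = m" by blast
      show ?thesis
      proof (cases "?X \<subseteq> ?T")
        \<comment> \<open>A path that ends at \<open>x\<close> and does not touch \<open>c\<close>
          has wait 0, so it is missing from \<open>N j\<close> and saves the one.\<close>
        case False
        then obtain e where "e \<in> ?X - ?T" by blast
        then have "e \<in> (touch ?S - ?T) \<inter> ?X" by (auto simp: touch_def)
        then have "card (touch ?S - ?T - ?X) < card (touch ?S - ?T)" by (intro psubset_card_mono) auto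
        then show ?thesis using True N_le M T_card tops_le that(1) by (simp add: Q_def)
      next
        txt \<open>Both paths ending at \<open>x\<close> come from \<open>c\<close>, so \<open>x\<close> is a top of \<open>?t\<close> that \<open>c\<close> lacks.\<close>
        case X: True
        have "m \<in> ?X" "l \<in> ?X" using m l by auto
        with X have "m \<in> ?T" "l \<in> ?T" by blast+
        with m l x_notin[OF c(1)] have "v (nx m) \<in> nodes c" "v l \<in> nodes c" by (auto simp: touch_def)
        with c(1) have "v (nx m) \<in> ?S" "v l \<in> ?S" by auto
        moreover have "below ?t x y" if "y \<in> ?S" for y
          unfolding below_def using that by (intro bexI[of _ ?t]) auto
        ultimately have "l \<in> tops ?t" using l m by (simp add: tops_def)
        moreover have "l \<notin> tops c" using l m x_notin[OF c(1)] tops_nodes[of l c] by auto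
        ultimately have "card (tops c) < card (tops ?t)" using tops_sub by (intro psubset_card_mono) auto
        then show ?thesis using True N_le M T_card diff_le that(1) by (simp add: Q_def)
      qed
    qed
  qed
  show ?case
  proof (cases "x \<in> ?VS \<or> up ?S = {}")
    case True
    have "schedule ?t V w"
      unfolding schedule_def
    proof (intro conjI allI ballI impI)
      fix j assume "1 \<le> j" "{i \<in> up ?S. j \<le> w i} \<noteq> {}"
      with bound[of j] True show "card {i \<in> up ?S. j \<le> w i} + j \<le> card (touch ?S) + card (tops ?t)"
        unfolding N_def Q_def by auto
    qed (use V_sub V_disj full held in blast)+
    then show ?thesis by blast
  next
    case False
    then have x: "x \<notin> ?VS" and ne: "up ?S \<noteq> {}" by auto
    \<comment> \<open>By maximality \<open>s\<close> belongs to every nonempty \<open>N j\<close>,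
      so serving it lowers all these counts at once.\<close>
    obtain s where s: "s \<in> up ?S" "\<And>i. i \<in> up ?S \<Longrightarrow> w i \<le> w s"
    proof -
      have "Max (w ` up ?S) \<in> w ` up ?S" using ne by (intro Max_in) auto
      then obtain s where "s \<in> up ?S" "w s = Max (w ` up ?S)" by auto
      then show ?thesis by (intro that[of s]) auto
    qed
    have "s < k" using s(1) by (simp add: up_def)
    with x have xs: "x \<notin> {v s, v (nx s)}" by auto
    have "1 \<le> w s" using xs by (simp add: w_def)
    have "s \<in> N (w s)" using s(1) by (simp add: N_def)
    then have ne': "N (w s) \<noteq> {}" by blast
    with finite_N have "card (N (w s)) > 0" by (simp add: card_gt_0_iff)
    \<comment> \<open>As \<open>s\<close> itself is counted in \<open>N (w s)\<close>, the bound
      \<open>Suc Q\<close> leaves at most \<open>Q\<close> for its wait, and \<open>Q\<close> is at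
      most \<open>k + k div 2\<close>. So the jump to \<open>x\<close> is short enough.\<close>
    with bound[OF \<open>1 \<le> w s\<close> ne'] x have "w s \<le> Q" by simp
    then have "w s \<le> D"
      using card_touch_le[of ?S] card_tops_le[OF dist] unfolding Q_def D_eq by linarith
    define V' where "V' = V(s := insert x (V s))"
    define w' where "w' = w(s := 0)"
    have V': "V i \<subseteq> V' i" for i by (auto simp: V'_def)
    have "schedule ?t V' w'"
      unfolding schedule_def
    proof (intro conjI allI ballI impI)
      show "V' i \<subseteq> ?S - ?VS" for i using V_sub[of i] x by (auto simp: V'_def)
    next
      show "V' i \<inter> V' j = {}" if "i \<noteq> j" for i j
        using that V_disj[of i j] V_sub[of i] V_sub[of j] by (auto simp: V'_def)
    next
      show "conn (V' i) i" if "i \<in> full ?S" for i using full[OF that] V' conn_mono by blast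
    next
      fix i assume i: "i \<in> up ?S"
      show "held ?t (V' i) (w' i) i"
      proof (cases "i = s")
        case False
        with held_mono[OF held[OF i] V'] show ?thesis by (simp add: w'_def)
      next
        case True
        from held[OF s(1)] obtain a z where a: "a \<in> {v s, v (nx s)} \<inter> ?S" "reach E D (V s) a z"
          "near E (w s) z x" unfolding held_def by auto
        from a(3) \<open>w s \<le> D\<close> have "near E D z x" by (rule near_mono)
        with reach_mono[OF a(2) V'] have "reach E D (V' s) a x"
          by (rule reach_step) (simp add: V'_def)
        moreover have "near E (w' s) x (label ?t)" by simp
        ultimately show ?thesis using a(1) unfolding True held_def by blast
      qed
    next
      fix j assume j: "1 \<le> j" "{i \<in> up ?S. j \<le> w' i} \<noteq> {}"
      have eq: "{i \<in> up ?S. j \<le> w' i} = N j - {s}"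
        using j(1) by (auto simp: N_def w'_def)
      with j(2) obtain i where "i \<in> N j" by blast
      then have "i \<in> up ?S" "j \<le> w i" by (auto simp: N_def)
      with s have "s \<in> N j" by (auto simp: N_def intro: le_trans)
      then have "Suc (card (N j - {s})) = card (N j)" using finite_N by (intro card.remove[symmetric]) auto
      moreover have "card (N j) + j \<le> Suc Q" using bound[OF j(1)] x \<open>s \<in> N j\<close> by auto
      ultimately show "card {i \<in> up ?S. j \<le> w' i} + j \<le> card (touch ?S) + card (tops ?t)"
        unfolding eq Q_def by linarith
    qed
    then show ?thesis by blast
  qed
qed

end

section \<open>Closed sequences of vertices\<close>

definition closed_seq :: "('a \<Rightarrow> 'a \<Rightarrow> bool) \<Rightarrow> 'a list \<Rightarrow> bool" where
  "closed_seq R xs \<longleftrightarrow> xs \<noteq> [] \<and> successively R (xs @ [hd xs])"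

lemma closed_seq_map: "closed_seq R (map f xs) \<longleftrightarrow> closed_seq (\<lambda>x y. R (f x) (f y)) xs"
proof (cases "xs = []")
  case False
  then have "map f xs @ [hd (map f xs)] = map f (xs @ [hd xs])" by (simp add: hd_map)
  then show ?thesis by (simp only: closed_seq_def successively_map map_is_Nil_conv)
qed (simp add: closed_seq_def)

lemma closed_seq_mono:
  assumes "closed_seq R xs" "\<And>x y. x \<in> set xs \<Longrightarrow> y \<in> set xs \<Longrightarrow> R x y \<Longrightarrow> Q x y"
  shows "closed_seq Q xs"
  using assms unfolding closed_seq_def by (auto elim!: successively_mono)

lemma successively_concat:
  assumes "\<forall>b\<in>set bs. b \<noteq> [] \<and> successively R b" "successively (\<lambda>b c. R (last b) (hd c)) bs"
  shows "successively R (concat bs)"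
  using assms
proof (induction bs)
  case (Cons b bs)
  then show ?case
    by (cases bs) (auto simp: successively_append_iff successively_Cons)
qed simp

lemma closed_seq_concat:
  assumes "\<forall>b\<in>set bs. b \<noteq> [] \<and> successively R b" "closed_seq (\<lambda>b c. R (last b) (hd c)) bs"
  shows "closed_seq R (concat bs)"
proof -
  have ne: "bs \<noteq> []" and "successively (\<lambda>b c. R (last b) (hd c)) (bs @ [hd bs])"
    using assms(2) by (simp_all add: closed_seq_def)
  \<comment> \<open>The closing copy of the first block enters only through its head, so it may be
    cut down to that head.\<close>
  then have "successively (\<lambda>b c. R (last b) (hd c)) (bs @ [[hd (hd bs)]])"
    by (simp add: successively_append_iff)
  then have "successively R (concat (bs @ [[hd (hd bs)]]))"
    using assms(1) by (intro successively_concat) auto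
  with ne assms(1) show ?thesis
    by (cases bs) (auto simp: closed_seq_def)
qed

lemma subseq_map_hd_concat:
  "\<forall>b\<in>set bs. b \<noteq> [] \<Longrightarrow> subseq (map hd bs) (concat bs)"
proof (induction bs)
  case (Cons b bs)
  then obtain x xs where "b = x # xs" by (cases b) auto
  with Cons show ?case by (auto intro: list_emb_append2)
qed simp

section \<open>Simple paths from reachability\<close>

lemma reach_cases: "reach E n U x y \<Longrightarrow> y = x \<or> y \<in> U"
  unfolding reach_def by (induction rule: rtranclp_induct) auto

lemma reach_trans: "reach E n U x y \<Longrightarrow> reach E n U y z \<Longrightarrow> reach E n U x z"
  unfolding reach_def by (rule rtranclp_trans)

text \<open>The reversed walk ends in \<open>x\<close>, which need not belong to \<open>U\<close>;
  hence the insertion.\<close>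

lemma reach_reverse:
  assumes "symp E" "reach E n U x y"
  shows "reach E n (insert x U) y x"
  using assms(2)[unfolded reach_def]
proof (induction rule: rtranclp_induct)
  case (step y z)
  from step.hyps(1) have "y = x \<or> y \<in> U" using reach_cases[of E n U x y] by (simp add: reach_def)
  then have "reach E n (insert x U) z y"
    using step.hyps(2) near_sym[OF assms(1)] by (intro reach_step[OF reach_refl]) auto
  with step.IH show ?case by (rule reach_trans[rotated])
qed simp

lemma reach_distinct_path:
  assumes "reach E n U x y"
  shows "\<exists>p. successively (near E n) (x # p) \<and> last (x # p) = y \<and> distinct (x # p) \<and> set p \<subseteq> U"
  using assms[unfolded reach_def]
proof (induction rule: rtranclp_induct)
  case base
  show ?case by (intro exI[of _ "[]"]) simp
next
  case (step y z)
  then obtain p where p: "successively (near E n) (x # p)" "last (x # p) = y" "distinct (x # p)"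
    "set p \<subseteq> U" by blast
  show ?case
  proof (cases "z \<in> set (x # p)")
    case True
    \<comment> \<open>When \<open>z\<close> is met again, the detour since its earlier visit is
      dropped.\<close>
    then obtain as bs where s: "x # p = as @ z # bs" using split_list[OF True] by blast
    show ?thesis
    proof (cases as)
      case Nil
      with s have "z = x" by simp
      then show ?thesis by (intro exI[of _ "[]"]) simp
    next
      case (Cons a q)
      with s p show ?thesis
        by (intro exI[of _ "q @ [z]"])
          (auto simp: successively_append_iff successively_Cons hd_append split: if_splits)
    qed
  next
    case False
    with p step.hyps show ?thesis
      by (intro exI[of _ "p @ [z]"])
        (auto simp: successively_append_iff successively_Cons split: if_splits)
  qed
qed

context routing
begin

text \<open>The first half, the joining jump and the reversed second half form a walk. Once it is
  shortened to a simple path, \<open>v (nx i)\<close> occurs only at its end, so the inner vertices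
  lie in \<open>U\<close>.\<close>

lemma conn_imp_path:
  assumes "conn U i" "i < k" "U \<inter> v ` {..<k} = {}"
  shows "\<exists>p. distinct p \<and> set p \<subseteq> U \<and> successively (near E D) (v i # p @ [v (nx i)])"
proof -
  let ?b = "v (nx i)" and ?W = "insert (v (nx i)) U"
  from assms(1) obtain z z' where z: "reach E D U (v i) z" "reach E D U ?b z'" "near E D z z'"
    unfolding conn_def by blast
  have "reach E D ?W (v i) z'"
  proof (rule reach_step)
    show "reach E D ?W (v i) z" using z(1) by (rule reach_mono) auto
    show "z' \<in> ?W" using reach_cases[OF z(2)] by auto
  qed (rule z)
  with reach_reverse[OF symp_E z(2)] have "reach E D ?W (v i) ?b" by (rule reach_trans[rotated])
  from reach_distinct_path[OF this] obtain p where p: "successively (near E D) (v i # p)"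
    "last (v i # p) = ?b" "distinct (v i # p)" "set p \<subseteq> ?W" by blast
  have "v i \<noteq> ?b" using assms(2) by simp
  with p(2) have "p \<noteq> []" "last p = ?b" by (auto split: if_splits)
  then obtain q where "p = q @ [?b]" by (metis append_butlast_last_id)
  with p show ?thesis by (intro exI[of _ q]) auto
qed

lemma ex_closed_seq_through_terminals:
  assumes t: "distinct (labs t)" "linked E t" "v ` {..<k} \<subseteq> nodes t"
  shows "\<exists>cs. distinct cs \<and> set cs \<subseteq> nodes t \<and> closed_seq (near E D) cs \<and> hd cs = v 0 \<and>
    subseq (map v [0..<k]) cs"
proof -
  from balanced_rerooting[OF symp_E t(1,2)] obtain t' where t': "distinct (labs t')" "linked E t'"
    "nodes t' = nodes t" "balanced t'" by blast
  from ex_schedule[OF t'(1,2,4)] obtain U w where "schedule t' U w" by blast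
  then have U: "\<And>i. U i \<subseteq> nodes t - v ` {..<k}" "\<And>i j. i \<noteq> j \<Longrightarrow> U i \<inter> U j = {}"
    "\<And>i. i \<in> full (nodes t) \<Longrightarrow> conn (U i) i"
    unfolding schedule_def t'(3) by blast+
  have "\<exists>p. distinct p \<and> set p \<subseteq> U i \<and> successively (near E D) (v i # p @ [v (nx i)])" if "i < k" for i
  proof (rule conn_imp_path)
    show "conn (U i) i" using that t(3) by (intro U(3)) (auto simp: full_def)
    show "U i \<inter> v ` {..<k} = {}" using U(1) by blast
  qed (rule that)
  then obtain P where P: "\<And>i. i < k \<Longrightarrow> distinct (P i)" "\<And>i. i < k \<Longrightarrow> set (P i) \<subseteq> U i"
    "\<And>i. i < k \<Longrightarrow> successively (near E D) (v i # P i @ [v (nx i)])" by metis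
  \<comment> \<open>A block stops before \<open>v (nx i)\<close>, which opens the next
    block.\<close>
  define B where "B i = v i # P i" for i
  let ?bs = "map B [0..<k]"
  have B_set: "set (B i) \<subseteq> insert (v i) (U i)" if "i < k" for i using P(2)[OF that] by (auto simp: B_def)
  have vU: "v i \<notin> U j" if "i < k" for i j using U(1)[of j] that by blast
  have B_disj: "set (B i) \<inter> set (B j) = {}" if "i < k" "j < k" "i \<noteq> j" for i j
    using B_set[OF that(1)] B_set[OF that(2)] U(2)[OF that(3)] vU[OF that(1), of j] vU[OF that(2), of i]
      v_eq_iff[OF that(1,2)] that(3) by blast
  have B_dist: "distinct (B i)" if "i < k" for i
    using P(1,2)[OF that] vU[OF that, of i] by (auto simp: B_def)
  have B_inj: "inj_on B {0..<k}"
    by (auto simp: inj_on_def B_def)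
  have "distinct (concat ?bs)"
  proof (rule distinct_concat)
    show "distinct ?bs" using B_inj by (simp add: distinct_map)
    show "distinct b" if "b \<in> set ?bs" for b using that B_dist by auto
    show "set b \<inter> set c = {}" if "b \<in> set ?bs" "c \<in> set ?bs" "b \<noteq> c" for b c
    proof -
      from that(1,2) obtain i j where ij: "i < k" "j < k" "b = B i" "c = B j" by auto
      with that(3) have "i \<noteq> j" by blast
      with B_disj ij show ?thesis by blast
    qed
  qed
  moreover have "set (concat ?bs) \<subseteq> nodes t"
    using B_set U(1) t(3) by fastforce
  moreover have "closed_seq (near E D) (concat ?bs)"
  proof (rule closed_seq_concat)
    have last_B: "near E D (last (B i)) (v (nx i))" "successively (near E D) (B i)" if "i < k" for i
      using P(3)[OF that] successively_append_iff[of "near E D" "B i" "[v (nx i)]"] by (auto simp: B_def)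
    then show "\<forall>b\<in>set ?bs. b \<noteq> [] \<and> successively (near E D) b" by (auto simp: B_def)
    have "closed_seq (\<lambda>i j. near E D (last (B i)) (v j)) [0..<k]"
      unfolding closed_seq_def
    proof
      show "[0..<k] \<noteq> []" using three_le_k by simp
      have "near E D (last (B i)) (v (Suc i))" if "Suc i < k" for i
        using last_B(1)[of i] that by (simp add: nx_def)
      then have "successively (\<lambda>i j. near E D (last (B i)) (v j)) [0..<k]"
        by (auto simp: successively_conv_nth)
      moreover have "near E D (last (B (k - 1))) (v 0)"
        using last_B(1)[of "k - 1"] three_le_k by (simp add: nx_def)
      ultimately show "successively (\<lambda>i j. near E D (last (B i)) (v j)) ([0..<k] @ [hd [0..<k]])"
        using three_le_k by (simp add: successively_append_iff last_upt hd_upt)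
    qed
    then show "closed_seq (\<lambda>b c. near E D (last b) (hd c)) ?bs"
      by (simp add: closed_seq_map B_def)
  qed
  moreover have "hd (concat ?bs) = v 0"
    using three_le_k by (simp add: upt_conv_Cons B_def)
  moreover have "subseq (map v [0..<k]) (concat ?bs)"
    using subseq_map_hd_concat[of ?bs] by (simp add: B_def o_def)
  ultimately show ?thesis by blast
qed

end

section \<open>Extension to a Hamiltonian sequence\<close>

text \<open>By the reversal, the block of a child ends at the child and starts within 1 of it, so
  consecutive blocks are within 3 and the last vertex is within 1 of the root.\<close>

fun rose_seq :: "'a rose \<Rightarrow> 'a list" where
  "rose_seq (Rose x ts) = x # concat (map (\<lambda>t. rev (rose_seq t)) ts)"

lemma set_rose_seq [simp]: "set (rose_seq t) = nodes t"
  by (induction t) auto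

lemma rose_seq_neq_Nil [simp]: "rose_seq t \<noteq> []"
  by (cases t) simp

lemma hd_rose_seq [simp]: "hd (rose_seq t) = label t"
  by (cases t) simp

lemma distinct_rose_seq: "distinct (labs t) \<Longrightarrow> distinct (rose_seq t)"
proof (induction t)
  case (Rose x ts)
  then have "distinct (concat (map labs ts))" by simp
  then have "distinct (concat (map (\<lambda>t. rev (rose_seq t)) ts))"
    using Rose.IH by (induction ts) auto
  with Rose.prems show ?case by auto
qed

lemma rose_seq_near:
  assumes "symp E" "linked E t"
  shows "successively (near E 3) (rose_seq t) \<and> near E 1 (last (rose_seq t)) (label t)"
  using assms(2)
proof (induction t)
  case (Rose x ts)
  let ?bs = "[x] # map (\<lambda>t. rev (rose_seq t)) ts"
  have kid: "near E 1 x (label t)" "near E 1 (label t) x" "successively (near E 3) (rose_seq t)"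
    "near E 1 (last (rose_seq t)) (label t)" if "t \<in> set ts" for t
  proof -
    have "E x (label t)" "linked E t" using that Rose.prems by auto
    then show "near E 1 x (label t)" "near E 1 (label t) x" "successively (near E 3) (rose_seq t)"
      "near E 1 (last (rose_seq t)) (label t)"
      using Rose.IH[OF that] near_edge[of E] sympD[OF assms(1)] by blast+
  qed
  have blocks: "successively (near E 3) b" if "b \<in> set ?bs" for b
    using that successively_mono[OF kid(3) near_sym[OF assms(1)]] by auto
  have "successively (near E 3) (concat ?bs)"
  proof (rule successively_concat)
    \<comment> \<open>The three unit distances lead from the end \<open>u\<close> of the previous
      block to \<open>x\<close>, on to the next child, and to the first vertex of its reversed
      block. For the first child, \<open>u\<close> is \<open>x\<close>.\<close>
    have step: "near E 3 u (last (rose_seq t))" if "t \<in> set ts" "near E 1 u x" for t u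
      using near_trans[OF near_trans[OF that(2) kid(1)[OF that(1)]] near_sym[OF assms(1) kid(4)[OF that(1)]]]
      by (simp add: numeral_3_eq_3)
    then show "successively (\<lambda>b c. near E 3 (last b) (hd c)) ?bs"
      using kid(2) by (auto simp: successively_Cons successively_map hd_rev last_rev hd_map
          intro!: successively_if_sorted_wrt sorted_wrt_mono_rel[OF _ sorted_wrt_true])
    show "\<forall>b\<in>set ?bs. b \<noteq> [] \<and> successively (near E 3) b" using blocks by auto
  qed
  moreover have "near E 1 (last (concat ?bs)) x"
  proof (cases ts rule: rev_cases)
    case (snoc us t)
    with kid(2)[of t] show ?thesis by (simp add: last_rev)
  qed simp
  ultimately show ?case by simp
qed

text \<open>Each vertex of \<open>cs\<close> is replaced by a traversal ending within 1 of it, so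
  jumps between consecutive traversals grow by at most one. With \<open>2 \<le> n\<close>, the jumps
  of 3 inside a traversal also fit into \<open>n + 1\<close>.\<close>

lemma ex_closed_seq_covering:
  assumes E: "symp E" and V: "finite V"
    and grow: "\<And>S. S \<subset> V \<Longrightarrow> S \<noteq> {} \<Longrightarrow> \<exists>u\<in>S. \<exists>w\<in>V - S. E u w"
    and cs: "distinct cs" "set cs \<subseteq> V" "closed_seq (near E n) cs" and n: "2 \<le> n"
  shows "\<exists>ds. distinct ds \<and> set ds = V \<and> closed_seq (near E (n + 1)) ds \<and> hd ds = hd cs \<and>
    subseq cs ds"
proof -
  have "cs \<noteq> []" using cs(3) by (simp add: closed_seq_def)
  from spanning_forest[OF V grow cs(1,2) this] obtain fs where fs: "map label fs = cs"
    "distinct (concat (map labs fs))" "\<forall>t\<in>set fs. linked E t" "(\<Union>t\<in>set fs. nodes t) = V"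
    by blast
  let ?bs = "map rose_seq fs"
  have "distinct (concat ?bs)"
    using fs(2) by (induction fs) (auto simp: distinct_rose_seq)
  moreover have "set (concat ?bs) = V" using fs(4) by simp
  moreover have "closed_seq (near E (n + 1)) (concat ?bs)"
  proof (rule closed_seq_concat)
    have "successively (near E (n + 1)) (rose_seq t)" if "t \<in> set fs" for t
    proof (rule successively_mono)
      show "successively (near E 3) (rose_seq t)" using rose_seq_near[OF E] fs(3) that by blast
      show "near E (n + 1) x y" if "near E 3 x y" for x y
        using that by (rule near_mono) (use n in simp)
    qed
    then show "\<forall>b\<in>set ?bs. b \<noteq> [] \<and> successively (near E (n + 1)) b" by auto
    have "closed_seq (\<lambda>s t. near E n (label s) (label t)) fs"
      using cs(3) unfolding fs(1)[symmetric] closed_seq_map .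
    then have "closed_seq (\<lambda>s t. near E (n + 1) (last (rose_seq s)) (label t)) fs"
    proof (rule closed_seq_mono)
      fix s t assume "s \<in> set fs" "near E n (label s) (label t)"
      with near_trans[OF conjunct2[OF rose_seq_near[OF E]]] fs(3)
      show "near E (n + 1) (last (rose_seq s)) (label t)" by fastforce
    qed
    then show "closed_seq (\<lambda>b c. near E (n + 1) (last b) (hd c)) ?bs"
      by (simp add: closed_seq_map)
  qed
  moreover have "map hd ?bs = cs" using fs(1) by (simp add: o_def)
  then have "subseq cs (concat ?bs)" using subseq_map_hd_concat[of ?bs] by auto
  moreover have "hd (concat ?bs) = hd cs"
    using \<open>cs \<noteq> []\<close> fs(1) by (cases fs) auto
  ultimately show ?thesis by blast
qed

section \<open>Cycles in powers of graphs\<close>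

context pair_graph
begin

lemma near_imp_awalk:
  assumes "near (\<lambda>u w. (u, w) \<in> parcs G) n u w" "u \<in> pverts G"
  shows "\<exists>p. awalk u p w \<and> length p \<le> n"
proof -
  have "((\<lambda>u w. (u, w) \<in> parcs G) ^^ m) u w \<Longrightarrow> \<exists>p. awalk u p w \<and> length p = m" for m
  proof (induction m arbitrary: w)
    case 0
    with assms(2) show ?case by (intro exI[of _ "[]"]) (simp add: awalk_Nil_iff)
  next
    case (Suc m)
    then obtain y where y: "((\<lambda>u w. (u, w) \<in> parcs G) ^^ m) u y" "(y, w) \<in> parcs G" by auto
    with Suc.IH obtain p where p: "awalk u p y" "length p = m" by blast
    have "awalk y [(y, w)] w" using y(2) by (auto simp: awalk_simps dest: in_arcsD1 in_arcsD2)
    with p show ?case by (intro exI[of _ "p @ [(y, w)]"]) auto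
  qed
  with assms(1) show ?thesis unfolding near_def by blast
qed

lemma graph_power_arc:
  assumes "near (\<lambda>u w. (u, w) \<in> parcs G) n u w" "u \<in> pverts G" "w \<in> pverts G" "u \<noteq> w"
  shows "(u, w) \<in> parcs (graph_power G n)"
  using assms near_imp_awalk[OF assms(1,2)] by (simp add: graph_power_def graph_dist_le_iff)

text \<open>A walk from \<open>S\<close> to a vertex outside has an arc that leaves
  \<open>S\<close>.\<close>

lemma ex_edge_leaving:
  assumes "connected (with_proj G)" "S \<subset> pverts G" "S \<noteq> {}"
  shows "\<exists>u\<in>S. \<exists>w\<in>pverts G - S. (u, w) \<in> parcs G"
proof -
  from assms(2,3) obtain u w where u: "u \<in> S" and w: "w \<in> pverts G - S" by blast
  from symmetric_connected_imp_strongly_connected[OF _ assms(1)] pair_sym_arcs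
  have "strongly_connected (with_proj G)" by simp
  then have "u \<rightarrow>\<^sup>*\<^bsub>with_proj G\<^esub> w"
    using u w assms(2) by (auto simp: strongly_connected_def)
  then obtain p where "awalk u p w" by (auto simp: reachable_awalk)
  then show ?thesis using u w
  proof (induction p arbitrary: u)
    case Nil
    then show ?case by (auto simp: awalk_Nil_iff)
  next
    case (Cons e p)
    then have e: "e \<in> parcs G" "fst e = u" "awalk (snd e) p w" by (auto simp: awalk_Cons_iff)
    show ?case
    proof (cases "snd e \<in> S")
      case True
      with Cons e show ?thesis by blast
    next
      case False
      have "snd e \<in> pverts G" using arc_snd_in_verts[OF e(1)] .
      with False e Cons.prems show ?thesis by (intro bexI[of _ u] bexI[of _ "snd e"]) auto
    qed
  qed
qed

end

lemma (in pair_wf_digraph) awalk_zip: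
  assumes "successively (\<lambda>u w. (u, w) \<in> parcs G) (u # xs)" "u \<in> pverts G"
  shows "awalk u (zip (u # xs) xs) (last (u # xs)) \<and> awalk_verts u (zip (u # xs) xs) = u # xs"
  using assms
proof (induction xs arbitrary: u)
  case Nil
  then show ?case by (simp add: awalk_Nil_iff)
next
  case (Cons y ys)
  then have "(u, y) \<in> parcs G" "y \<in> pverts G" by (auto dest: in_arcsD2)
  with Cons.IH[of y] Cons.prems show ?case by (auto simp: awalk_Cons_iff)
qed

text \<open>The relation allows equal neighbours because \<open>near\<close> is reflexive;
  distinctness and the length then exclude them, also between the last and the first vertex.\<close>

lemma (in pair_wf_digraph) simple_cycle_of_closed_seq:
  assumes "distinct xs" "3 \<le> length xs" "set xs \<subseteq> pverts G"
    and "closed_seq (\<lambda>u w. u \<noteq> w \<longrightarrow> (u, w) \<in> parcs G) xs"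
  shows "\<exists>p. simple_cycle G p \<and> cycle_verts p = xs"
proof -
  obtain x ys where xs: "xs = x # ys" using assms(2) by (cases xs) auto
  let ?ys = "ys @ [x]"
  have succ: "successively (\<lambda>u w. u \<noteq> w \<longrightarrow> (u, w) \<in> parcs G) (x # ?ys)"
    using assms(4) xs by (simp add: closed_seq_def)
  have "successively (\<noteq>) xs" using assms(1) by (auto simp: successively_conv_nth nth_eq_iff_index_eq)
  have "ys \<noteq> []" using assms(2) xs by auto
  moreover have "x \<notin> set ys" using assms(1) xs by simp
  ultimately have "last xs \<noteq> x" using last_in_set[of ys] xs by auto
  with \<open>successively (\<noteq>) xs\<close> have "successively (\<noteq>) (xs @ [x])"
    by (simp add: successively_append_iff)
  then have "successively (\<noteq>) (x # ?ys)" using xs by simp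
  with succ have "successively (\<lambda>u w. (u, w) \<in> parcs G) (x # ?ys)"
    by (simp add: successively_conv_nth)
  from awalk_zip[OF this] assms(3) xs
  have p: "awalk x (zip (x # ?ys) ?ys) x" "awalk_verts x (zip (x # ?ys) ?ys) = x # ?ys" by auto
  have "cycle_verts (zip (x # ?ys) ?ys) = take (length ?ys) (x # ?ys)"
    by (simp only: cycle_verts_def map_fst_zip_take) simp
  then have "cycle_verts (zip (x # ?ys) ?ys) = xs" using xs by simp
  moreover have "cycle (zip (x # ?ys) ?ys)"
    unfolding cycle_def using p assms(1) xs by (intro exI[of _ x]) (auto simp del: zip_Cons_Cons)
  ultimately show ?thesis
    using assms(2) xs unfolding simple_cycle_def by (intro exI[of _ "zip (x # ?ys) ?ys"]) simp
qed

theorem theorem4p4: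
  fixes G :: "'a pair_pre_digraph" and k :: nat
  assumes "k \<ge> 3"
    and "pair_graph G"
    and "connected (with_proj G)"
    and "card (pverts G) \<ge> k"
  shows "k_ordered k (graph_power G ((3 * k) div 2)) \<and>
    k_ordered_hamiltonian k (graph_power G ((3 * k) div 2 + 1))"
proof -
  interpret pair_graph G by fact
  define E where "E = (\<lambda>u w. (u, w) \<in> parcs G)"
  let ?D = "(3 * k) div 2"
  have E: "symp E" using pair_sym_arcs by (auto simp: E_def symmetric_def symp_def dest: symD)
  have grow: "\<exists>u\<in>S. \<exists>w\<in>pverts G - S. E u w" if "S \<subset> pverts G" "S \<noteq> {}" for S
    unfolding E_def by (rule ex_edge_leaving[OF assms(3) that])
  have cyc: "\<exists>p. simple_cycle (graph_power G n) p \<and> cycle_verts p = xs"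
    if "distinct xs" "3 \<le> length xs" "set xs \<subseteq> pverts G" "closed_seq (near E n) xs" for n xs
  proof -
    interpret P: pair_graph "graph_power G n" by (rule pair_graph_graph_power)
    show ?thesis
    proof (rule P.simple_cycle_of_closed_seq)
      show "closed_seq (\<lambda>u w. u \<noteq> w \<longrightarrow> (u, w) \<in> parcs (graph_power G n)) xs"
        using that(4)
      proof (rule closed_seq_mono)
        fix u w assume "u \<in> set xs" "w \<in> set xs" "near E n u w"
        with that(3) graph_power_arc[of n u w] show "u \<noteq> w \<longrightarrow> (u, w) \<in> parcs (graph_power G n)"
          unfolding E_def by blast
      qed
    qed (use that in \<open>auto simp: graph_power_def\<close>)
  qed
  have *: "(\<exists>p. simple_cycle (graph_power G ?D) p \<and> meets_in_order p vs) \<and>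
      (\<exists>p. hamiltonian_cycle (graph_power G (?D + 1)) p \<and> meets_in_order p vs)"
    if vs: "length vs = k" "distinct vs" "set vs \<subseteq> pverts G" for vs
  proof -
    interpret routing k "(!) vs" E
      using assms(1) vs E by unfold_locales (auto simp: inj_on_def nth_eq_iff_index_eq)
    have "vs \<noteq> []" using vs assms(1) by auto
    have map_vs: "map ((!) vs) [0..<k] = vs" using map_nth[of vs] vs(1) by simp
    have "pverts G \<noteq> {}" using assms(1,4) by auto
    with spanning_rose[OF pair_finite_verts grow] obtain t where
      t: "distinct (labs t)" "linked E t" "nodes t = pverts G" by blast
    have "(!) vs ` {..<k} \<subseteq> nodes t" using vs t(3) by auto
    from ex_closed_seq_through_terminals[OF t(1,2) this] obtain cs where
      cs: "distinct cs" "set cs \<subseteq> pverts G" "closed_seq (near E ?D) cs" "hd cs = hd vs" "subseq vs cs"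
      unfolding t(3) map_vs using hd_conv_nth[OF \<open>vs \<noteq> []\<close>] by auto
    \<comment> \<open>Containing all \<open>k\<close> terminals makes the sequence long enough for a
      simple cycle.\<close>
    have "k \<le> length cs" using list_emb_length[OF cs(5)] vs(1) by simp
    have "2 \<le> ?D" using assms(1) by linarith
    from ex_closed_seq_covering[OF E pair_finite_verts grow cs(1-3) this] obtain ds where
      ds: "distinct ds" "set ds = pverts G" "closed_seq (near E (?D + 1)) ds" "hd ds = hd cs"
        "subseq cs ds" by blast
    have "k \<le> length ds" using list_emb_length[OF ds(5)] \<open>k \<le> length cs\<close> by simp
    have "subseq vs ds" using cs(5) ds(5) by (rule subseq_order.trans)
    from cyc[OF cs(1) _ cs(2,3)] \<open>k \<le> length cs\<close> assms(1) obtain p where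
      "simple_cycle (graph_power G ?D) p" "cycle_verts p = cs" by auto
    moreover from cyc[OF ds(1) _ _ ds(3)] ds(2) \<open>k \<le> length ds\<close> assms(1) obtain q where
      "simple_cycle (graph_power G (?D + 1)) q" "cycle_verts q = ds" by auto
    ultimately show ?thesis
      using cs ds \<open>subseq vs ds\<close> unfolding meets_in_order_def hamiltonian_cycle_def
      by (auto simp: graph_power_def)
  qed
  moreover have "pverts (graph_power G n) = pverts G" for n by (simp add: graph_power_def)
  ultimately show ?thesis unfolding k_ordered_def k_ordered_hamiltonian_def by simp
qed

end
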